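(* Let $T$ be any tree poset of height $2$. Then $$La_{rp}(n,T)= \left(1 + O_T\left(\sqrt{\frac{\log n}{n}}\right)\right) \binom{n}{\lfloor n/2 \rfloor},$$ i.e., there is a constant $C_T$ depending only on $T$ such that for all sufficiently large $n$, $$\left|\frac{La_{rp}(n,T)}{\binom{n}{\lfloor n/2\rfloor}}-1\right|\le C_T\sqrt{\frac{\log n}{n}}.$$
   Context: For a finite poset $P$, its Hasse diagram is the graph on the elements of $P$ in which $x,y$ are adjacent if $x<y$ and there is no $z\in P$ with $x<z<y$. A tree poset is a poset whose Hasse diagram is a tree. The height of a poset is the maximum number of elements in a chain. A poset $P$ is graded with rank function $\rho$ if $\rho(y)=\rho(x)+1$ whenever $y$ covers $x$ (for a tree poset such a rank function exists and is determined up to an additive constant). For a family $\mathcal F$ of subsets of $[n]=\{1,\dots,n\}$, a subfamily $\mathcal G\subseteq\mathcal F$ is a rank-preserving copy of the graded poset $P$ if there is a bijection $\phi:P\to\mathcal G$ such that $\phi(x)\subseteq\phi(y)$ whenever $x\le_P y$, and $|\phi(x)|=|\phi(y)|$ whenever $\rho(x)=\rho(y)$. $La_{rp}(n,P)$ denotes the maximum size of a family $\mathcal F\subseteq 2^{[n]}$ containing no rank-preserving copy of $P$. *)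

theory Defs
  imports Complex_Main
begin

text \<open>
  A poset is given by a carrier set \<open>P\<close> and a reflexive order relation \<open>r\<close> with
  \<open>partial_order_on P r\<close>.
\<close>

definition covered_by :: "'a set \<Rightarrow> 'a rel \<Rightarrow> 'a \<Rightarrow> 'a \<Rightarrow> bool" where
  "covered_by P r x y \<longleftrightarrow> x \<in> P \<and> y \<in> P \<and> (x, y) \<in> r \<and> x \<noteq> y \<and>
     \<not> (\<exists>z\<in>P. (x, z) \<in> r \<and> x \<noteq> z \<and> (z, y) \<in> r \<and> z \<noteq> y)"

definition hasse_diagram :: "'a set \<Rightarrow> 'a rel \<Rightarrow> 'a rel" where
  "hasse_diagram P r = {(x, y). covered_by P r x y \<or> covered_by P r y x}"

text \<open>
  Trees are meant in the sense of undirected simple graphs, given by a vertex set and a symmetric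
  irreflexive adjacency relation. (The AFP entry Graph_Theory has a constant \<open>tree\<close>, but its
  cycles are directed and may have length two, so it does not express this notion.)
\<close>

definition graph_cycle :: "'a rel \<Rightarrow> 'a list \<Rightarrow> bool" where
  "graph_cycle E c \<longleftrightarrow> length c \<ge> 3 \<and> distinct c \<and>
     (\<forall>i<length c. (c ! i, c ! (Suc i mod length c)) \<in> E)"

definition graph_connected :: "'a set \<Rightarrow> 'a rel \<Rightarrow> bool" where
  "graph_connected V E \<longleftrightarrow> V \<noteq> {} \<and> (\<forall>x\<in>V. \<forall>y\<in>V. (x, y) \<in> E\<^sup>*)"

definition graph_tree :: "'a set \<Rightarrow> 'a rel \<Rightarrow> bool" where
  "graph_tree V E \<longleftrightarrow> graph_connected V E \<and> \<not> (\<exists>c. graph_cycle E c)"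

definition tree_poset :: "'a set \<Rightarrow> 'a rel \<Rightarrow> bool" where
  "tree_poset P r \<longleftrightarrow> finite P \<and> partial_order_on P r \<and> graph_tree P (hasse_diagram P r)"

definition poset_height :: "'a set \<Rightarrow> 'a rel \<Rightarrow> nat" where
  "poset_height P r = Max {card C | C. C \<subseteq> P \<and> C \<in> Chains r}"

definition rank_function :: "'a set \<Rightarrow> 'a rel \<Rightarrow> ('a \<Rightarrow> int) \<Rightarrow> bool" where
  "rank_function P r \<rho> \<longleftrightarrow> (\<forall>x y. covered_by P r x y \<longrightarrow> \<rho> y = \<rho> x + 1)"

definition rank_preserving_copy_wrt ::
    "'a set \<Rightarrow> 'a rel \<Rightarrow> ('a \<Rightarrow> int) \<Rightarrow> nat set set \<Rightarrow> bool" where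
  "rank_preserving_copy_wrt P r \<rho> \<G> \<longleftrightarrow>
     (\<exists>\<phi>. bij_betw \<phi> P \<G> \<and>
          (\<forall>x\<in>P. \<forall>y\<in>P. (x, y) \<in> r \<longrightarrow> \<phi> x \<subseteq> \<phi> y) \<and>
          (\<forall>x\<in>P. \<forall>y\<in>P. \<rho> x = \<rho> y \<longrightarrow> card (\<phi> x) = card (\<phi> y)))"

text \<open>
  The rank function of a tree poset is unique up to an additive constant on \<open>P\<close>, so the choice of
  \<open>\<rho>\<close> is immaterial; see \<open>rank_preserving_copy_eq\<close> and \<open>rank_function_exists_height_2\<close> below.
\<close>

definition rank_preserving_copy :: "'a set \<Rightarrow> 'a rel \<Rightarrow> nat set set \<Rightarrow> bool" where
  "rank_preserving_copy P r \<G> \<longleftrightarrow>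
     (\<exists>\<rho>. rank_function P r \<rho> \<and> rank_preserving_copy_wrt P r \<rho> \<G>)"

definition La_rp :: "nat \<Rightarrow> 'a set \<Rightarrow> 'a rel \<Rightarrow> nat" where
  "La_rp n P r = Max {card \<F> | \<F>. \<F> \<subseteq> Pow {1..n} \<and>
     \<not> (\<exists>\<G>. \<G> \<subseteq> \<F> \<and> rank_preserving_copy P r \<G>)}"

lemma rank_function_unique:
  assumes "tree_poset P r" "rank_function P r \<rho>" "rank_function P r \<sigma>"
  shows "\<exists>d. \<forall>x\<in>P. \<sigma> x = \<rho> x + d"
proof -
  have conn: "P \<noteq> {}" "\<And>x y. x \<in> P \<Longrightarrow> y \<in> P \<Longrightarrow> (x, y) \<in> (hasse_diagram P r)\<^sup>*"
    using assms(1) by (auto simp: tree_poset_def graph_tree_def graph_connected_def)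
  have step: "\<sigma> x - \<rho> x = \<sigma> y - \<rho> y" if "(x, y) \<in> hasse_diagram P r" for x y
    using that assms(2,3) by (force simp: hasse_diagram_def rank_function_def)
  have path: "\<sigma> x - \<rho> x = \<sigma> y - \<rho> y" if "(x, y) \<in> (hasse_diagram P r)\<^sup>*" for x y
    using that by induction (auto dest: step)
  obtain x0 where "x0 \<in> P" using conn(1) by blast
  then have "\<forall>x\<in>P. \<sigma> x = \<rho> x + (\<sigma> x0 - \<rho> x0)"
    using path conn(2) by (metis add.commute diff_add_cancel)
  then show ?thesis by blast
qed

lemma rank_preserving_copy_eq:
  assumes "tree_poset P r" "rank_function P r \<rho>"
  shows "rank_preserving_copy P r \<G> \<longleftrightarrow> rank_preserving_copy_wrt P r \<rho> \<G>"
proof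
  assume "rank_preserving_copy P r \<G>"
  then obtain \<sigma> where \<sigma>: "rank_function P r \<sigma>" "rank_preserving_copy_wrt P r \<sigma> \<G>"
    by (auto simp: rank_preserving_copy_def)
  obtain d where "\<forall>x\<in>P. \<sigma> x = \<rho> x + d"
    using rank_function_unique[OF assms \<sigma>(1)] by blast
  then have "\<forall>x\<in>P. \<forall>y\<in>P. \<sigma> x = \<sigma> y \<longleftrightarrow> \<rho> x = \<rho> y" by simp
  with \<sigma>(2) show "rank_preserving_copy_wrt P r \<rho> \<G>"
    unfolding rank_preserving_copy_wrt_def by metis
qed (use assms in \<open>auto simp: rank_preserving_copy_def\<close>)

lemma rank_function_exists_height_2:
  assumes "tree_poset P r" "poset_height P r = 2"
  shows "\<exists>\<rho>. rank_function P r \<rho>"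
proof -
  have fin: "finite P" and po: "partial_order_on P r"
    using assms(1) by (auto simp: tree_poset_def)
  have refl: "\<And>x. x \<in> P \<Longrightarrow> (x, x) \<in> r" and tr: "trans r" and anti: "antisym r"
    using partial_order_onD[OF po] by (auto simp: refl_on_def)
  have no3: False if "covered_by P r x y" "covered_by P r y z" for x y z
  proof -
    have in_P: "x \<in> P" "y \<in> P" "z \<in> P" and rel: "(x, y) \<in> r" "(y, z) \<in> r"
      and ne: "x \<noteq> y" "y \<noteq> z"
      using that by (auto simp: covered_by_def)
    have xz: "(x, z) \<in> r" using rel tr by (blast dest: transD)
    have "x \<noteq> z" using rel ne anti by (blast dest: antisymD)
    then have "card {x, y, z} = 3" using ne by auto
    moreover have "{x, y, z} \<in> Chains r"
      using in_P rel xz refl by (auto simp: Chains_def)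
    moreover have "finite {card C | C. C \<subseteq> P \<and> C \<in> Chains r}"
      by (rule finite_subset[of _ "card ` Pow P"]) (use fin in auto)
    ultimately have "3 \<le> poset_height P r"
      unfolding poset_height_def using in_P
      by (intro Max_ge) (auto intro!: exI[of _ "{x, y, z}"])
    with assms(2) show False by simp
  qed
  have "rank_function P r (\<lambda>x. if \<exists>w. covered_by P r w x then 1 else 0)"
    unfolding rank_function_def using no3 by fastforce
  then show ?thesis by blast
qed

end

theory Submission
  imports Defs "HOL-Real_Asymp.Real_Asymp"
begin

text \<open>
  The middle layer contains no copy, which gives the lower bound. Conversely, let \<open>F\<close> contain no
  copy. Between any two levels \<open>i < j\<close> the containment graph of \<open>F\<close> does not contain the Hasse
  diagram of \<open>T\<close> (with the right colour classes), hence it has at most \<open>2 |T| (f\<^sub>i + f\<^sub>j)\<close> edges,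
  where \<open>f\<^sub>i\<close> is the number of members of \<open>F\<close> of size \<open>i\<close>. Let \<open>X\<close> count the members of \<open>F\<close> on
  a uniformly random maximal chain. Then \<open>E(X) - 1 \<le> E(X choose 2)\<close>, and the edge bounds together
  with \<open>\<Sum>0<t<N. 1 / (N choose t) \<le> 4 / N\<close> give \<open>E(X choose 2) = O(E(X) / n)\<close>, provided that
  \<open>F\<close> lives on the levels between \<open>n / 4\<close> and \<open>3 n / 4\<close>; the other levels are
  exponentially small. As \<open>|F| \<le> E(X) (n choose (n div 2))\<close>, the error term is even \<open>O(1 / n)\<close>.
\<close>

subsection \<open>Embedding trees into graphs of large minimum degree\<close>

text \<open>The path grows at its front; if the new vertex already lies on it, the path is cut back
  to the suffix starting at that vertex.\<close>

lemma rtrancl_imp_distinct_path: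
  assumes "(x, y) \<in> R\<^sup>*"
  shows "\<exists>p. p \<noteq> [] \<and> distinct p \<and> hd p = x \<and> last p = y \<and> successively (\<lambda>a b. (a, b) \<in> R) p"
  using assms
proof (induction rule: converse_rtrancl_induct)
  case base
  then show ?case by (intro exI[of _ "[y]"]) simp
next
  case (step x z)
  then obtain p where p: "p \<noteq> []" "distinct p" "hd p = z" "last p = y"
    "successively (\<lambda>a b. (a, b) \<in> R) p" by blast
  show ?case
  proof (cases "x \<in> set p")
    case True
    then obtain as bs where "p = as @ x # bs" by (meson split_list)
    with p show ?thesis
      by (intro exI[of _ "x # bs"]) (auto simp: successively_append_iff)
  next
    case False
    with p step show ?thesis
      by (intro exI[of _ "x # p"]) (auto simp: successively_Cons)
  qed
qed

text \<open>Otherwise a simple path from \<open>u\<close> to \<open>w\<close> inside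
  \<open>S\<close>, closed up through \<open>v\<close>, would be a cycle. Thus a vertex attached to
  a connected part of a tree has a single neighbour there.\<close>

lemma acyclic_unique_neighbour:
  assumes "\<not> (\<exists>c. graph_cycle E c)" "sym E"
    and conn: "(u, w) \<in> (E \<inter> S \<times> S)\<^sup>*"
    and "v \<notin> S" "u \<in> S" "(v, u) \<in> E" "(v, w) \<in> E"
  shows "u = w"
proof (rule ccontr)
  assume "u \<noteq> w"
  obtain p where p: "p \<noteq> []" "distinct p" "hd p = u" "last p = w"
    "successively (\<lambda>a b. (a, b) \<in> E \<inter> S \<times> S) p"
    using rtrancl_imp_distinct_path[OF conn] by blast
  have step: "(p ! i, p ! Suc i) \<in> E \<inter> S \<times> S" if "Suc i < length p" for i
    using p(5) that
  proof (induction p arbitrary: i)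
    case (Cons a p)
    then show ?case by (cases i) (auto simp: successively_Cons hd_conv_nth)
  qed simp
  have "set p \<subseteq> S"
  proof
    fix a assume "a \<in> set p"
    then obtain i where i: "i < length p" "a = p ! i" by (auto simp: in_set_conv_nth)
    then show "a \<in> S"
    proof (cases i)
      case 0
      with i p assms show ?thesis by (simp add: hd_conv_nth)
    next
      case (Suc k)
      with i step[of k] show ?thesis by simp
    qed
  qed
  with assms have "v \<notin> set p" by blast
  have "(w, v) \<in> E" using assms by (blast dest: symD)
  \<comment> \<open>A cycle needs three vertices, so together with \<open>v\<close> the path has to
    contribute two.\<close>
  have len: "length p \<ge> 2"
    using p \<open>u \<noteq> w\<close> by (cases p; cases "tl p") auto
  have "((v # p) ! i, (v # p) ! (Suc i mod length (v # p))) \<in> E" if "i < length (v # p)" for i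
  proof -
    consider "i = 0" | k where "i = Suc k" "Suc k < length p" | "i = length p" "p \<noteq> []"
      using \<open>i < length (v # p)\<close> p(1) by (cases i) (auto simp: less_Suc_eq)
    then show ?thesis
    proof cases
      case 1
      then show ?thesis using p assms by (simp add: hd_conv_nth)
    next
      case 2
      then show ?thesis using step[of k] by simp
    next
      case 3
      then show ?thesis using p \<open>(w, v) \<in> E\<close> by (simp add: last_conv_nth nth_Cons')
    qed
  qed
  with \<open>v \<notin> set p\<close> p len have "graph_cycle E (v # p)"
    by (auto simp: graph_cycle_def)
  with assms(1) show False by blast
qed

lemma rtrancl_leaves_set:
  assumes "(x, y) \<in> E\<^sup>*" "x \<in> S" "y \<notin> S"
  shows "\<exists>u v. (u, v) \<in> E \<and> u \<in> S \<and> v \<notin> S"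
  using assms by (induction rule: rtrancl_induct) blast+

text \<open>The tree is embedded one vertex at a time: each new vertex is adjacent to exactly one
  embedded vertex, and the minimum degree leaves a free neighbour for its image.\<close>

lemma tree_embedding:
  assumes tree: "graph_tree T E" and T: "finite T" "E \<subseteq> T \<times> T" and E: "sym E" "irrefl E"
    and V: "finite V" "v0 \<in> V" and H: "sym H"
    and deg: "\<And>v. v \<in> V \<Longrightarrow> card {w \<in> V. (v, w) \<in> H} \<ge> card T"
    and x0: "x0 \<in> T"
  shows "\<exists>f. inj_on f T \<and> f ` T \<subseteq> V \<and> f x0 = v0 \<and> (\<forall>x y. (x, y) \<in> E \<longrightarrow> (f x, f y) \<in> H)"
proof -
  \<comment> \<open>A good set is connected by edges inside itself, so that
    \<open>acyclic_unique_neighbour\<close> applies to vertices outside it. A good set of greatest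
    size is shown to be \<open>T\<close>.\<close>
  define good where "good S \<longleftrightarrow> S \<subseteq> T \<and> x0 \<in> S \<and> (\<forall>x\<in>S. \<forall>y\<in>S. (x, y) \<in> (E \<inter> S \<times> S)\<^sup>*) \<and>
    (\<exists>f. inj_on f S \<and> f ` S \<subseteq> V \<and> f x0 = v0 \<and> (\<forall>x\<in>S. \<forall>y\<in>S. (x, y) \<in> E \<longrightarrow> (f x, f y) \<in> H))"
    for S
  have "good {x0}"
    unfolding good_def using x0 V E by (auto simp: irrefl_def intro!: exI[of _ "\<lambda>_. v0"])
  moreover have "\<forall>S. good S \<longrightarrow> card S < Suc (card T)"
    using T(1) by (auto simp: good_def less_Suc_eq_le intro: card_mono)
  ultimately obtain S where S: "good S" "\<And>S'. good S' \<Longrightarrow> card S' \<le> card S"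
    using ex_has_greatest_nat[of good "{x0}" card "Suc (card T)"] by auto
  have "S = T"
  proof (rule ccontr)
    assume "S \<noteq> T"
    then obtain y where y: "y \<in> T" "y \<notin> S" using S(1) by (auto simp: good_def)
    have "(x0, y) \<in> E\<^sup>*"
      using tree x0 y by (auto simp: graph_tree_def graph_connected_def)
    then obtain u v where uv: "(u, v) \<in> E" "u \<in> S" "v \<notin> S"
      using rtrancl_leaves_set S(1) y unfolding good_def by metis
    have vu: "(v, u) \<in> E" using uv E(1) by (auto dest: symD)
    have vT: "v \<in> T" using uv T by auto
    have finS: "finite S" and ST: "S \<subset> T"
      using S(1) T \<open>S \<noteq> T\<close> finite_subset by (auto simp: good_def)
    obtain f where f: "inj_on f S" "f ` S \<subseteq> V" "f x0 = v0"
      "\<And>x y. x \<in> S \<Longrightarrow> y \<in> S \<Longrightarrow> (x, y) \<in> E \<Longrightarrow> (f x, f y) \<in> H"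
      and conn: "\<And>x y. x \<in> S \<Longrightarrow> y \<in> S \<Longrightarrow> (x, y) \<in> (E \<inter> S \<times> S)\<^sup>*"
      using S(1) unfolding good_def by auto
    \<comment> \<open>The image of \<open>S\<close> is too small to contain all neighbours of
      \<open>f u\<close>, so one of them is free.\<close>
    have "card (f ` S) < card T"
      using card_image_le[OF finS, of f] psubset_card_mono[OF T(1) ST] by linarith
    also have "\<dots> \<le> card {w \<in> V. (f u, w) \<in> H}"
      using deg f(2) uv by blast
    finally have "\<not> {w \<in> V. (f u, w) \<in> H} \<subseteq> f ` S"
      using card_mono[of "f ` S" "{w \<in> V. (f u, w) \<in> H}"] finS by auto
    then obtain w where w: "w \<in> V" "(f u, w) \<in> H" "w \<notin> f ` S" by blast
    let ?S = "insert v S" and ?f = "f(v := w)"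
    \<comment> \<open>Only the edge between \<open>u\<close> and \<open>v\<close> is new, so
      adjacency of the images of \<open>u\<close> and \<open>v\<close> is all that the extended map
      needs.\<close>
    have uniq: "a = u" if "a \<in> S" "(v, a) \<in> E" for a
      using acyclic_unique_neighbour[of E a u S v] tree E conn that uv vu
      by (auto simp: graph_tree_def)
    have mono: "(E \<inter> S \<times> S)\<^sup>* \<subseteq> (E \<inter> ?S \<times> ?S)\<^sup>*" by (rule rtrancl_mono) auto
    have to_v: "(a, v) \<in> (E \<inter> ?S \<times> ?S)\<^sup>*" "(v, a) \<in> (E \<inter> ?S \<times> ?S)\<^sup>*" if "a \<in> S" for a
    proof -
      have "(a, u) \<in> (E \<inter> ?S \<times> ?S)\<^sup>*" "(u, a) \<in> (E \<inter> ?S \<times> ?S)\<^sup>*"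
        using conn mono that uv by auto
      moreover have "(u, v) \<in> E \<inter> ?S \<times> ?S" "(v, u) \<in> E \<inter> ?S \<times> ?S" using uv vu by auto
      ultimately show "(a, v) \<in> (E \<inter> ?S \<times> ?S)\<^sup>*" "(v, a) \<in> (E \<inter> ?S \<times> ?S)\<^sup>*"
        by (meson rtrancl.rtrancl_into_rtrancl, meson converse_rtrancl_into_rtrancl)
    qed
    have "good ?S"
      unfolding good_def
    proof (intro conjI exI[of _ ?f])
      show "?S \<subseteq> T" "x0 \<in> ?S" using S(1) vT by (auto simp: good_def)
      show "\<forall>x\<in>?S. \<forall>y\<in>?S. (x, y) \<in> (E \<inter> ?S \<times> ?S)\<^sup>*"
        using to_v conn mono by blast
      show "inj_on ?f ?S" using f(1) w uv by (auto simp: inj_on_def)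
      show "?f ` ?S \<subseteq> V" using f(2) w by auto
      show "?f x0 = v0" using f(3) uv S(1) by (auto simp: good_def)
      show "\<forall>x\<in>?S. \<forall>y\<in>?S. (x, y) \<in> E \<longrightarrow> (?f x, ?f y) \<in> H"
      proof (intro ballI impI)
        fix x y assume xy: "x \<in> ?S" "y \<in> ?S" "(x, y) \<in> E"
        then have "(y, x) \<in> E" "x \<noteq> y" using E by (auto dest: symD simp: irrefl_def)
        have "(w, f u) \<in> H" using H w(2) by (rule symD)
        consider "x \<in> S" "y \<in> S" | "x = v" "y \<in> S" | "x \<in> S" "y = v"
          using xy \<open>x \<noteq> y\<close> by blast
        then show "(?f x, ?f y) \<in> H"
        proof cases
          case 1
          then show ?thesis using f(4) xy uv by auto
        next
          case 2
          then show ?thesis using uniq[of y] xy \<open>(w, f u) \<in> H\<close> uv by auto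
        next
          case 3
          then show ?thesis using uniq[of x] \<open>(y, x) \<in> E\<close> w uv by auto
        qed
      qed
    qed
    then have "card ?S \<le> card S" by (rule S(2))
    with finS uv show False by simp
  qed
  with S(1) obtain f where "inj_on f T" "f ` T \<subseteq> V" "f x0 = v0"
    "\<And>x y. x \<in> T \<Longrightarrow> y \<in> T \<Longrightarrow> (x, y) \<in> E \<Longrightarrow> (f x, f y) \<in> H"
    unfolding good_def by auto
  with T(2) show ?thesis by (intro exI[of _ f]) auto
qed

text \<open>A bipartite graph with many edges contains a subgraph of large minimum degree, obtained by
  repeatedly deleting a vertex of small degree.\<close>

lemma bipartite_edges_le_if_tree_free:
  fixes c :: "'a \<Rightarrow> bool" and d :: "'b \<Rightarrow> bool"
  assumes tree: "graph_tree T E" "finite T" "E \<subseteq> T \<times> T" "sym E"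
    and c: "\<And>x y. (x, y) \<in> E \<Longrightarrow> c x \<noteq> c y"
    and d: "\<And>a b. (a, b) \<in> H \<Longrightarrow> d a \<noteq> d b"
    and "finite V"
    and free: "\<not> (\<exists>f. inj_on f T \<and> f ` T \<subseteq> V \<and> (\<forall>x\<in>T. d (f x) = c x) \<and>
                 (\<forall>x y. (x, y) \<in> E \<longrightarrow> (f x, f y) \<in> H \<union> H\<inverse>))"
  shows "card (H \<inter> V \<times> V) \<le> 2 * card T * card V"
  using \<open>finite V\<close> free
proof (induction "card V" arbitrary: V rule: less_induct)
  case less
  let ?N = "\<lambda>v. {w \<in> V. (v, w) \<in> H \<union> H\<inverse>}"
  show ?case
  proof (cases "V = {}")
    case False
    have "\<exists>v\<in>V. card (?N v) < card T"
    proof (rule ccontr)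
      assume "\<not> ?thesis"
      then have deg: "\<And>v. v \<in> V \<Longrightarrow> card T \<le> card (?N v)" by (auto simp: not_less)
      obtain x0 where x0: "x0 \<in> T" using tree by (auto simp: graph_tree_def graph_connected_def)
      obtain v1 where v1: "v1 \<in> V" using False by blast
      have "card T > 0" using x0 tree card_gt_0_iff by blast
      with deg[OF v1] have "card (?N v1) > 0" by linarith
      then have "?N v1 \<noteq> {}" by (metis card.empty less_irrefl)
      then obtain v2 where v2: "v2 \<in> V" "(v1, v2) \<in> H \<union> H\<inverse>" by blast
      then have "d v1 \<noteq> d v2" using d by auto
      \<comment> \<open>The two ends of an edge of \<open>H\<close> show both colours, so one of
        them has the colour of the root \<open>x0\<close>.\<close>
      then obtain v0 where v0: "v0 \<in> V" "d v0 = c x0" using v1 v2 by (cases "d v1 = c x0") auto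
      have "irrefl E" "sym (H \<union> H\<inverse>)" using c by (auto simp: irrefl_def intro: sym_Un_converse)
      from tree_embedding[OF tree this(1) less.prems(1) v0(1) this(2) deg x0]
      obtain f where f: "inj_on f T" "f ` T \<subseteq> V" "f x0 = v0"
        "\<And>x y. (x, y) \<in> E \<Longrightarrow> (f x, f y) \<in> H \<union> H\<inverse>" by blast
      \<comment> \<open>Colours alternate along the edges of both graphs, so agreement at
        \<open>x0\<close> spreads over the whole tree.\<close>
      have "d (f x) = c x" if "(x0, x) \<in> E\<^sup>*" for x
        using that
      proof induction
        case base
        then show ?case using f(3) v0 by simp
      next
        case (step y z)
        then have "d (f y) \<noteq> d (f z)" "c y \<noteq> c z" using f(4)[of y z] d c by auto
        with step show ?case by blast
      qed
      then have "\<forall>x\<in>T. d (f x) = c x"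
        using tree x0 by (auto simp: graph_tree_def graph_connected_def)
      with f less.prems(2) show False by blast
    qed
    then obtain v where v: "v \<in> V" "card (?N v) < card T" by blast
    let ?V = "V - {v}"
    have fin: "finite (?N v)" using less.prems by auto
    have "card ?V < card V" using v less.prems by (meson card_Diff1_less)
    then have IH: "card (H \<inter> ?V \<times> ?V) \<le> 2 * card T * card ?V"
      using less.hyps[of ?V] less.prems by blast
    \<comment> \<open>Each lost pair joins \<open>v\<close> to one of its neighbours in one of two
      orders, which accounts for the factor 2 in the bound.\<close>
    have "H \<inter> V \<times> V \<subseteq> (H \<inter> ?V \<times> ?V) \<union> (Pair v ` ?N v \<union> (\<lambda>w. (w, v)) ` ?N v)"
      by auto
    then have "card (H \<inter> V \<times> V) \<le> card ((H \<inter> ?V \<times> ?V) \<union> (Pair v ` ?N v \<union> (\<lambda>w. (w, v)) ` ?N v))"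
      using fin less.prems by (intro card_mono) auto
    also have "\<dots> \<le> card (H \<inter> ?V \<times> ?V) + (card (Pair v ` ?N v) + card ((\<lambda>w. (w, v)) ` ?N v))"
      by (meson card_Un_le add_left_mono order_trans)
    also have "\<dots> \<le> 2 * card T * card ?V + (card (?N v) + card (?N v))"
      using IH fin by (intro add_mono card_image_le) auto
    also have "\<dots> \<le> 2 * card T * card ?V + 2 * card T" using v by simp
    also have "\<dots> = 2 * card T * Suc (card ?V)" by simp
    also have "Suc (card ?V) = card V" using v less.prems by (metis card_Suc_Diff1)
    finally show ?thesis .
  qed simp
qed

subsection \<open>A supersaturated LYM inequality\<close>

text \<open>A uniformly random maximal chain below \<^term>\<open>S\<close> starts by deleting a uniformly random
  element of \<^term>\<open>S\<close>.\<close>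

lemma sum_inverse_choose_average:
  fixes h :: "'a set \<Rightarrow> real"
  assumes "finite S" "F \<subseteq> Pow S" "S \<notin> F"
  shows "(\<Sum>B\<in>F. h B / (card S choose card B)) =
    (\<Sum>x\<in>S. \<Sum>B | B \<in> F \<and> x \<notin> B. h B / (card (S - {x}) choose card B)) / card S"
proof -
  have finF: "finite F" using assms finite_subset by blast
  have single: "h B / (card S choose card B) =
      (\<Sum>x | x \<in> S \<and> x \<notin> B. h B / (card (S - {x}) choose card B)) / card S" if "B \<in> F" for B
  proof -
    have "B \<subset> S" using assms that by auto
    then have lt: "card B < card S" using assms psubset_card_mono by blast
    have "{x \<in> S. x \<notin> B} = S - B" by auto
    also have "card \<dots> = card S - card B"
      using \<open>B \<subset> S\<close> assms(1) by (intro card_Diff_subset) (auto intro: finite_subset)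
    finally have "(\<Sum>x | x \<in> S \<and> x \<notin> B. h B / (card (S - {x}) choose card B)) =
        (card S - card B) * (h B / ((card S - 1) choose card B))"
      using assms(1) by simp
    moreover have "real (card S - card B) * (card S choose card B) = card S * ((card S - 1) choose card B)"
      using binomial_absorb_comp[of "card S" "card B"] by (metis of_nat_mult)
    moreover have "(card S choose card B) > 0" "((card S - 1) choose card B) > 0" "card S > 0"
      using lt by (auto simp: zero_less_binomial_iff)
    ultimately show ?thesis by (simp add: divide_simps) (auto simp: mult_ac)
  qed
  have "(\<Sum>B\<in>F. h B / (card S choose card B)) =
      (\<Sum>B\<in>F. \<Sum>x | x \<in> S \<and> x \<notin> B. h B / (card (S - {x}) choose card B)) / card S"
    using single by (simp add: sum_divide_distrib)
  also have "(\<Sum>B\<in>F. \<Sum>x | x \<in> S \<and> x \<notin> B. h B / (card (S - {x}) choose card B)) =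
      (\<Sum>x\<in>S. \<Sum>B | B \<in> F \<and> x \<notin> B. h B / (card (S - {x}) choose card B))"
    using finF assms(1) by (rule sum.swap_restrict)
  finally show ?thesis .
qed

text \<open>If \<open>X\<close> is the number of members of \<^term>\<open>F\<close> on a uniformly random maximal chain, the
  inequality says that \<open>E(X) - E(X choose 2) \<le> 1\<close>.\<close>

lemma supersaturated_LYM:
  assumes "finite S" "F \<subseteq> Pow S"
  shows "(\<Sum>B\<in>F. (1 - (\<Sum>A | A \<in> F \<and> A \<subset> B. 1 / real (card B choose card A))) /
           (card S choose card B)) \<le> 1"
  using assms
proof (induction "card S" arbitrary: S F)
  case 0
  then have "F \<subseteq> {{}}" by auto
  then show ?case by (auto simp: subset_singleton_iff)
next
  case (Suc n)
  let ?h = "\<lambda>F B. \<Sum>A | A \<in> F \<and> A \<subset> B. 1 / real (card B choose card A)"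
  have finF: "finite F" using Suc.prems finite_subset by blast
  show ?case
  proof (cases "S \<in> F")
    case True
    let ?F = "F - {S}"
    have "(\<Sum>B\<in>F. (1 - ?h F B) / (card S choose card B)) =
        (1 - ?h F S) + (\<Sum>B\<in>?F. (1 - ?h F B) / (card S choose card B))"
      using True finF by (simp add: sum.remove)
    also have "{A \<in> F. A \<subset> S} = ?F" using Suc.prems by auto
    \<comment> \<open>The pairs below \<open>S\<close> cancel the main terms of all other sets; what
      remains is 1 minus nonnegative corrections.\<close>
    also have "(1 - (\<Sum>A\<in>?F. 1 / real (card S choose card A))) +
        (\<Sum>B\<in>?F. (1 - ?h F B) / (card S choose card B)) =
        1 - (\<Sum>B\<in>?F. ?h F B / (card S choose card B))"
      by (simp add: diff_divide_distrib sum_subtractf)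
    also have "\<dots> \<le> 1" by (simp add: sum_nonneg)
    finally show ?thesis .
  next
    case False
    have "(\<Sum>B\<in>F. (1 - ?h F B) / (card S choose card B)) =
      (\<Sum>x\<in>S. \<Sum>B | B \<in> F \<and> x \<notin> B. (1 - ?h F B) / (card (S - {x}) choose card B)) / card S"
      by (rule sum_inverse_choose_average) (use Suc.prems False in auto)
    also have "\<dots> \<le> (\<Sum>x\<in>S. 1) / card S"
    proof (intro divide_right_mono sum_mono)
      fix x assume x: "x \<in> S"
      let ?F = "{B. B \<in> F \<and> x \<notin> B}"
      \<comment> \<open>Subsets of a set avoiding \<open>x\<close> avoid \<open>x\<close> too, so
        the correction terms survive the passage to \<open>S - {x}\<close>.\<close>
      have "?h F B = ?h ?F B" if "B \<in> ?F" for B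
        by (rule sum.cong) (use that in auto)
      then have "(\<Sum>B | B \<in> F \<and> x \<notin> B. (1 - ?h F B) / (card (S - {x}) choose card B)) =
          (\<Sum>B | B \<in> F \<and> x \<notin> B. (1 - ?h ?F B) / (card (S - {x}) choose card B))"
        by (intro sum.cong) auto
      also have "\<dots> \<le> 1"
        by (rule Suc.hyps(1)) (use Suc.prems Suc.hyps(2) x in auto)
      finally show "(\<Sum>B | B \<in> F \<and> x \<notin> B. (1 - ?h F B) / (card (S - {x}) choose card B)) \<le> 1" .
    qed simp
    also have "\<dots> \<le> 1" by simp
    finally show ?thesis .
  qed
qed

subsection \<open>Estimates for binomial coefficients\<close>

text \<open>Binomial coefficients are monotone on each side of the middle; in the upper half the
  comparison is with \<open>N choose (N - 2)\<close>.\<close>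

lemma choose_two_le_choose:
  assumes "2 \<le> t" "t + 2 \<le> N"
  shows "N choose 2 \<le> N choose t"
proof (cases "2 * t \<le> N")
  case True
  with assms show ?thesis by (intro binomial_mono) auto
next
  case False
  have "N choose 2 = N choose (N - 2)" using assms by (intro binomial_symmetric) auto
  also have "\<dots> \<le> N choose t" using assms False by (intro binomial_antimono) auto
  finally show ?thesis .
qed

text \<open>Each of the two end terms is \<open>1 / N\<close>, and each other term is at most
  \<open>1 / (N choose 2)\<close>. Charging the latter for all \<open>N - 1\<close> indices adds
  another \<open>2 / N\<close>. For \<open>N < 2\<close> the sum is empty.\<close>

lemma sum_inverse_choose_le: "(\<Sum>t\<in>{1..<N}. 1 / real (N choose t)) \<le> 4 / real N"
proof (cases "N \<ge> 2")
  case True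
  have "1 / real (N choose t) \<le>
      (if t = 1 then 1 / N else 0) + (if t = N - 1 then 1 / N else 0) + 2 / (real N * (real N - 1))"
    (is "_ \<le> ?b t") if t: "t \<in> {1..<N}" for t
  proof -
    have nn: "0 \<le> 2 / (real N * (real N - 1))" using True by simp
    consider "t = 1" | "t = N - 1" | "2 \<le> t" "t + 2 \<le> N" using t by force
    then show ?thesis
    proof cases
      case 1
      then show ?thesis using nn by auto
    next
      case 2
      have "N choose (N - 1) = N" using True binomial_symmetric[of 1 N] by simp
      with 2 show ?thesis using nn by auto
    next
      case 3
      have "real N * (real N - 1) / 2 = real (N choose 2)"
        using True by (simp add: choose_two real_of_nat_div of_nat_diff)
      also have "\<dots> \<le> real (N choose t)" using choose_two_le_choose[OF 3] by simp
      finally have "1 / real (N choose t) \<le> 1 / (real N * (real N - 1) / 2)"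
        using True t by (intro divide_left_mono) (auto intro!: mult_pos_pos simp: zero_less_binomial_iff)
      also have "\<dots> \<le> ?b t" by simp
      finally show ?thesis .
    qed
  qed
  then have "(\<Sum>t\<in>{1..<N}. 1 / real (N choose t)) \<le> (\<Sum>t\<in>{1..<N}. ?b t)"
    by (intro sum_mono)
  also have "\<dots> = 1 / N + 1 / N + (real N - 1) * (2 / (real N * (real N - 1)))"
    using True by (simp add: sum.distrib sum.delta of_nat_diff)
  also have "\<dots> = 4 / N" using True by (simp add: field_simps)
  finally show ?thesis .
qed auto

text \<open>The ratio of consecutive coefficients is \<open>(n - k) / (k + 1)\<close>, which is at
  least 2 exactly when \<open>3 * (k + 1) \<le> n + 1\<close>.\<close>

lemma choose_doubling:
  assumes "3 * (i + s) \<le> n + 1"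
  shows "2 ^ s * (n choose i) \<le> n choose (i + s)"
  using assms
proof (induction s)
  case (Suc s)
  let ?k = "i + s"
  have "Suc ?k * (2 * (n choose ?k)) \<le> (n - ?k) * (n choose ?k)"
    using Suc.prems by (simp only: mult.assoc[symmetric]) (intro mult_right_mono, auto)
  also have "\<dots> = Suc ?k * (n choose Suc ?k)"
    by (simp only: binomial_absorption binomial_absorb_comp)
  finally have "2 * (n choose ?k) \<le> n choose Suc ?k" by (simp only: Suc_mult_le_cancel1)
  with Suc show ?case by simp
qed simp

text \<open>Each extreme level is smaller than the middle one by a factor of at least
  \<open>2 ^ (n div 12)\<close>, and there are at most \<open>n + 1\<close> levels.\<close>

lemma card_extreme_sets_le:
  fixes n :: nat
  shows "real (card {A \<in> Pow {1..n}. \<not> (n div 4 \<le> card A \<and> card A \<le> n - n div 4)}) \<le>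
    (real n + 1) / 2 ^ (n div 12) * (n choose (n div 2))"
proof -
  let ?M = "n choose (n div 2)"
  let ?I = "{i \<in> {..n}. \<not> (n div 4 \<le> i \<and> i \<le> n - n div 4)}"
  let ?D = "{A \<in> Pow {1..n}. \<not> (n div 4 \<le> card A \<and> card A \<le> n - n div 4)}"
  have low: "real (n choose i) \<le> ?M / 2 ^ (n div 12)" if "i < n div 4" for i
  proof -
    \<comment> \<open>Starting below \<open>n / 4\<close>, a climb of \<open>n div 12\<close> levels
      ends below \<open>n / 3\<close>, inside the doubling range.\<close>
    have "2 ^ (n div 12) * (n choose i) \<le> n choose (i + n div 12)"
      using that times_div_less_eq_dividend[of 4 n] times_div_less_eq_dividend[of 12 n]
      by (intro choose_doubling) (simp add: algebra_simps)
    also have "\<dots> \<le> ?M" by (rule binomial_maximum)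
    finally have "real (2 ^ (n div 12) * (n choose i)) \<le> real ?M" by (simp only: of_nat_le_iff)
    then show ?thesis by (simp add: field_simps)
  qed
  have "?D \<subseteq> (\<Union>i\<in>?I. {A. A \<subseteq> {1..n} \<and> card A = i})"
    using card_mono[of "{1..n}"] by fastforce
  then have "card ?D \<le> card (\<Union>i\<in>?I. {A. A \<subseteq> {1..n} \<and> card A = i})"
    by (intro card_mono) auto
  also have "\<dots> \<le> (\<Sum>i\<in>?I. card {A. A \<subseteq> {1..n} \<and> card A = i})"
    by (intro card_UN_le) auto
  also have "\<dots> = (\<Sum>i\<in>?I. n choose i)" by (simp add: n_subsets)
  finally have "real (card ?D) \<le> (\<Sum>i\<in>?I. real (n choose i))"
    by (simp only: of_nat_sum[symmetric] of_nat_le_iff)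
  also have "\<dots> \<le> (\<Sum>i\<in>?I. ?M / 2 ^ (n div 12))"
  proof (rule sum_mono)
    fix i assume i: "i \<in> ?I"
    show "real (n choose i) \<le> ?M / 2 ^ (n div 12)"
    proof (cases "i < n div 4")
      case False
      then have "n - i < n div 4" using i by auto
      then show ?thesis using low[of "n - i"] i binomial_symmetric[of i n] by simp
    qed (rule low)
  qed
  also have "\<dots> = card ?I * (?M / 2 ^ (n div 12))" by simp
  also have "\<dots> \<le> (real n + 1) * (?M / 2 ^ (n div 12))"
  proof (rule mult_right_mono)
    have "card ?I \<le> card {..n}" by (intro card_mono) auto
    then show "real (card ?I) \<le> real n + 1" by simp
  qed simp
  finally show ?thesis by simp
qed

subsection \<open>Sparse families have at most about the size of the middle layer\<close>

text \<open>The left side is the expected number of pairs of members of \<open>F\<close> on a random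
  maximal chain. Pairs are grouped by their sizes, \<open>sparse\<close> bounds each group, and
  summing over the size of the other partner costs at most \<open>4 / a\<close> on either
  side.\<close>

lemma weighted_pairs_le:
  fixes F :: "nat set set" and K :: real
  assumes F: "F \<subseteq> Pow {1..n}" and a: "0 < a"
    and range: "\<And>A. A \<in> F \<Longrightarrow> a \<le> card A \<and> card A \<le> n - a"
    and K: "0 \<le> K"
    and sparse: "\<And>i j. i < j \<Longrightarrow>
      real (card {(A, B) \<in> F \<times> F. card A = i \<and> card B = j \<and> A \<subset> B}) \<le>
        K * (card {A \<in> F. card A = i} + card {A \<in> F. card A = j})"
  shows "(\<Sum>B\<in>F. (\<Sum>A | A \<in> F \<and> A \<subset> B. 1 / real (card B choose card A)) / (n choose card B)) \<le>
    8 * K / a * (\<Sum>B\<in>F. 1 / real (n choose card B))"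
proof -
  have finF: "finite F" using F finite_subset by blast
  have finA: "finite A" if "A \<in> F" for A using F that finite_subset by blast
  define L where "L = {a..n - a}"
  define f where "f i = real (card {A \<in> F. card A = i})" for i
  \<comment> \<open>The probability that a random maximal chain passes through a given pair of
    nested sets of sizes \<open>i < j\<close>.\<close>
  define q where "q i j = 1 / (real (n choose j) * real (j choose i))" for i j
  define Q where "Q = {(A, B) \<in> F \<times> F. A \<subset> B}"
  define Qij where "Qij i j = {(A, B) \<in> F \<times> F. card A = i \<and> card B = j \<and> A \<subset> B}" for i j
  define X where "X = (\<Sum>B\<in>F. 1 / real (n choose card B))"
  have finL: "finite L" by (simp add: L_def)
  have finQ: "finite Q" using finF by (intro finite_subset[of Q "F \<times> F"]) (auto simp: Q_def)
  have X: "X = (\<Sum>j\<in>L. f j / (n choose j))"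
  proof -
    have "X = (\<Sum>j\<in>L. \<Sum>B | B \<in> F \<and> card B = j. 1 / real (n choose card B))"
      unfolding X_def using finF range by (subst sum.group) (auto simp: L_def)
    then show ?thesis by (simp add: f_def)
  qed
  have "(\<Sum>B\<in>F. (\<Sum>A | A \<in> F \<and> A \<subset> B. 1 / real (card B choose card A)) / (n choose card B)) =
      (\<Sum>B\<in>F. \<Sum>A | A \<in> F \<and> A \<subset> B. q (card A) (card B))"
    by (simp add: q_def sum_divide_distrib mult.commute)
  also have "\<dots> = (\<Sum>A\<in>F. \<Sum>B | B \<in> F \<and> A \<subset> B. q (card A) (card B))"
    using finF by (intro sum.swap_restrict)
  also have "\<dots> = (\<Sum>(A, B)\<in>Q. q (card A) (card B))"
    using finF by (subst sum.Sigma) (auto simp: Q_def intro!: sum.cong)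
  also have "\<dots> = (\<Sum>ij\<in>L \<times> L. \<Sum>AB | AB \<in> Q \<and> (case AB of (A, B) \<Rightarrow> (card A, card B)) = ij.
      case AB of (A, B) \<Rightarrow> q (card A) (card B))"
    using finQ range by (subst sum.group) (auto simp: Q_def L_def)
  also have "\<dots> = (\<Sum>(i, j)\<in>L \<times> L. card (Qij i j) * q i j)"
  proof (rule sum.cong[OF refl], clarify)
    fix i j
    have "(\<Sum>AB | AB \<in> Q \<and> (case AB of (A, B) \<Rightarrow> (card A, card B)) = (i, j).
      case AB of (A, B) \<Rightarrow> q (card A) (card B)) = (\<Sum>AB\<in>Qij i j. q i j)"
      by (rule sum.cong) (auto simp: Q_def Qij_def)
    then show "(\<Sum>AB | AB \<in> Q \<and> (case AB of (A, B) \<Rightarrow> (card A, card B)) = (i, j).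
      case AB of (A, B) \<Rightarrow> q (card A) (card B)) = card (Qij i j) * q i j" by simp
  qed
  also have "\<dots> \<le> (\<Sum>(i, j)\<in>L \<times> L. if i < j then K * (f i + f j) * q i j else 0)"
  proof (rule sum_mono, clarify)
    fix i j
    show "card (Qij i j) * q i j \<le> (if i < j then K * (f i + f j) * q i j else 0)"
    proof (cases "i < j")
      case True
      have "real (card (Qij i j)) \<le> K * (f i + f j)"
        using sparse[OF True] by (simp add: Qij_def f_def)
      with True show ?thesis by (simp add: q_def divide_right_mono)
    next
      case False
      have "card A < card B" if "B \<in> F" "A \<subset> B" for A B
        using psubset_card_mono[OF finA] that by blast
      with False have "Qij i j = {}" by (auto simp: Qij_def)
      with False show ?thesis by simp
    qed
  qed
  \<comment> \<open>The two summands of the edge bound are separated: \<open>f i\<close> is summed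
    over the larger size \<open>j\<close>, and \<open>f j\<close> over the smaller size
    \<open>i\<close>.\<close>
  also have "\<dots> = (\<Sum>i\<in>L. \<Sum>j\<in>L. (if i < j then K * f i * q i j else 0) + (if i < j then K * f j * q i j else 0))"
    unfolding sum.cartesian_product by (intro sum.cong refl) (auto simp: algebra_simps)
  also have "\<dots> = (\<Sum>i\<in>L. \<Sum>j\<in>L. if i < j then K * f i * q i j else 0) +
                  (\<Sum>j\<in>L. \<Sum>i\<in>L. if i < j then K * f j * q i j else 0)"
    by (simp add: sum.distrib) (rule sum.swap)
  also have "(\<Sum>i\<in>L. \<Sum>j\<in>L. if i < j then K * f i * q i j else 0) =
      (\<Sum>i\<in>L. K * f i * (\<Sum>j | j \<in> L \<and> i < j. q i j))"
    unfolding sum_distrib_left sum.inter_filter[OF finL] by (intro sum.cong refl) simp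
  also have "(\<Sum>j\<in>L. \<Sum>i\<in>L. if i < j then K * f j * q i j else 0) =
      (\<Sum>j\<in>L. K * f j * (\<Sum>i | i \<in> L \<and> i < j. q i j))"
    unfolding sum_distrib_left sum.inter_filter[OF finL] by (intro sum.cong refl) simp
  also have "(\<Sum>i\<in>L. K * f i * (\<Sum>j | j \<in> L \<and> i < j. q i j)) +
      (\<Sum>j\<in>L. K * f j * (\<Sum>i | i \<in> L \<and> i < j. q i j)) \<le>
      (\<Sum>i\<in>L. K * f i * (4 / a / (n choose i))) + (\<Sum>j\<in>L. K * f j * (4 / a / (n choose j)))"
  proof (intro add_mono sum_mono mult_left_mono)
    fix i assume i: "i \<in> L"
    have "(\<Sum>j | j \<in> L \<and> i < j. q i j) =
        (\<Sum>j | j \<in> L \<and> i < j. 1 / real ((n - i) choose (j - i))) / (n choose i)"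
      unfolding sum_divide_distrib
    proof (rule sum.cong[OF refl])
      fix j assume "j \<in> {j. j \<in> L \<and> i < j}"
      \<comment> \<open>Counting the nested pairs from the smaller set upwards instead makes the
        factor \<open>n choose i\<close> independent of \<open>j\<close>.\<close>
      then have "(n choose j) * (j choose i) = (n choose i) * ((n - i) choose (j - i))"
        using choose_mult[of i j n] by (auto simp: L_def)
      then have "real (n choose j) * (j choose i) = real (n choose i) * ((n - i) choose (j - i))"
        by (metis of_nat_mult)
      then show "q i j = 1 / real ((n - i) choose (j - i)) / (n choose i)"
        by (simp add: q_def mult.commute)
    qed
    also have "(\<Sum>j | j \<in> L \<and> i < j. 1 / real ((n - i) choose (j - i))) =
        (\<Sum>t\<in>(\<lambda>j. j - i) ` {j. j \<in> L \<and> i < j}. 1 / real ((n - i) choose t))"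
      by (subst sum.reindex) (auto simp: inj_on_def)
    \<comment> \<open>Since \<open>0 < a\<close>, every \<open>j\<close> in \<open>L\<close> is less
      than \<open>n\<close>, so \<open>j - i\<close> stays strictly below
      \<open>n - i\<close>.\<close>
    also have "\<dots> \<le> (\<Sum>t\<in>{1..<n - i}. 1 / real ((n - i) choose t))"
      using a by (intro sum_mono2) (auto simp: L_def)
    also have "\<dots> \<le> 4 / real (n - i)" by (rule sum_inverse_choose_le)
    also have "\<dots> \<le> 4 / a" using i a by (intro divide_left_mono) (auto simp: L_def)
    finally show "(\<Sum>j | j \<in> L \<and> i < j. q i j) \<le> 4 / a / (n choose i)"
      by (simp add: divide_right_mono)
  next
    fix j assume j: "j \<in> L"
    have "(\<Sum>i | i \<in> L \<and> i < j. q i j) = (\<Sum>i | i \<in> L \<and> i < j. 1 / real (j choose i)) / (n choose j)"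
      by (simp add: q_def sum_divide_distrib mult.commute)
    also have "(\<Sum>i | i \<in> L \<and> i < j. 1 / real (j choose i)) \<le> (\<Sum>t\<in>{1..<j}. 1 / real (j choose t))"
      using a by (intro sum_mono2) (auto simp: L_def)
    also have "\<dots> \<le> 4 / real j" by (rule sum_inverse_choose_le)
    also have "\<dots> \<le> 4 / a" using j a by (intro divide_left_mono) (auto simp: L_def)
    finally show "(\<Sum>i | i \<in> L \<and> i < j. q i j) \<le> 4 / a / (n choose j)"
      by (simp add: divide_right_mono)
  qed (use K in \<open>auto simp: f_def\<close>)
  also have "\<dots> = 8 * K / a * X"
    unfolding X by (simp add: sum_distrib_left mult.assoc)
  finally show ?thesis unfolding X_def .
qed

text \<open>With \<open>e = 8 * K / a\<close>, the previous results give
  \<open>X \<le> 1 + e * X\<close>. As \<open>e \<le> 1 / 2\<close>, first \<open>X \<le> 2\<close>,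
  and feeding this back gives \<open>X \<le> 1 + 2 * e\<close>. Each set contributes to
  \<open>X\<close> at least the inverse of the middle binomial coefficient.\<close>

lemma card_sparse_family_le:
  fixes F :: "nat set set" and K :: real
  assumes F: "F \<subseteq> Pow {1..n}" and a: "0 < a"
    and range: "\<And>A. A \<in> F \<Longrightarrow> a \<le> card A \<and> card A \<le> n - a"
    and K: "0 \<le> K" "16 * K \<le> a"
    and sparse: "\<And>i j. i < j \<Longrightarrow>
      real (card {(A, B) \<in> F \<times> F. card A = i \<and> card B = j \<and> A \<subset> B}) \<le>
        K * (card {A \<in> F. card A = i} + card {A \<in> F. card A = j})"
  shows "real (card F) \<le> (1 + 16 * K / a) * (n choose (n div 2))"
proof -
  let ?M = "n choose (n div 2)"
  define X where "X = (\<Sum>B\<in>F. 1 / real (n choose card B))"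
  define e where "e = 8 * K / a"
  have "X - (\<Sum>B\<in>F. (\<Sum>A | A \<in> F \<and> A \<subset> B. 1 / real (card B choose card A)) / (n choose card B)) \<le> 1"
    using supersaturated_LYM[OF _ F] by (simp add: X_def diff_divide_distrib sum_subtractf)
  with weighted_pairs_le[OF F a range K(1) sparse] have X1: "X \<le> 1 + e * X"
    by (simp add: X_def e_def)
  have e: "0 \<le> e" "e \<le> 1 / 2" using K a by (auto simp: e_def field_simps)
  have "X \<ge> 0" by (simp add: X_def sum_nonneg)
  then have "e * X \<le> 1 / 2 * X" using e by (intro mult_right_mono)
  with X1 have "X \<le> 2" by simp
  then have "e * X \<le> e * 2" using e by (intro mult_left_mono)
  with X1 have X2: "X \<le> 1 + 16 * K / a" by (simp add: e_def)
  have "real (card F) / ?M = (\<Sum>B\<in>F. 1 / real ?M)" by simp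
  also have "\<dots> \<le> X"
    unfolding X_def
  proof (intro sum_mono divide_left_mono)
    fix B assume "B \<in> F"
    then have "card B \<le> n" using range by fastforce
    then show "0 < real ?M * real (n choose card B)" by (simp add: zero_less_binomial_iff)
  qed (use binomial_maximum in auto)
  finally have "real (card F) / ?M \<le> 1 + 16 * K / a" using X2 by simp
  then show ?thesis by (simp add: divide_le_eq zero_less_binomial_iff)
qed

subsection \<open>Tree posets of height two\<close>

lemma height_two_no_chain_three:
  assumes "finite P" "partial_order_on P r" "poset_height P r = 2"
    and "(x, y) \<in> r" "(y, z) \<in> r" "x \<noteq> y" "y \<noteq> z"
  shows False
proof -
  have rP: "r \<subseteq> P \<times> P" and refl: "\<And>x. x \<in> P \<Longrightarrow> (x, x) \<in> r" and tr: "trans r" and anti: "antisym r"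
    using partial_order_onD[OF assms(2)] assms(2)
    by (auto simp: refl_on_def partial_order_on_def preorder_on_def)
  have xz: "(x, z) \<in> r" using assms tr by (blast dest: transD)
  have "x \<noteq> z" using assms anti by (blast dest: antisymD)
  then have "card {x, y, z} = 3" using assms by auto
  moreover have "{x, y, z} \<in> Chains r" "{x, y, z} \<subseteq> P"
    using assms(4,5) xz refl rP by (auto simp: Chains_def)
  moreover have "finite {card C | C. C \<subseteq> P \<and> C \<in> Chains r}"
    by (rule finite_subset[of _ "card ` Pow P"]) (use assms in auto)
  ultimately have "3 \<le> poset_height P r"
    unfolding poset_height_def by (intro Max_ge) (auto intro!: exI[of _ "{x, y, z}"])
  with assms(3) show False by simp
qed

lemma height_two_ex_strict_pair:
  assumes "finite P" "partial_order_on P r" "poset_height P r = 2"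
  shows "\<exists>x\<in>P. \<exists>y\<in>P. (x, y) \<in> r \<and> x \<noteq> y"
proof -
  let ?H = "{card C | C. C \<subseteq> P \<and> C \<in> Chains r}"
  have "finite ?H"
    by (rule finite_subset[of _ "card ` Pow P"]) (use assms in auto)
  moreover have "card {} \<in> ?H" by (auto simp: Chains_def intro!: exI[of _ "{}"])
  ultimately have "poset_height P r \<in> ?H"
    unfolding poset_height_def by (intro Max_in) auto
  then obtain C where C: "C \<subseteq> P" "C \<in> Chains r" "card C = 2" using assms(3) by auto
  then obtain x y where "C = {x, y}" "x \<noteq> y" by (auto simp: card_2_iff)
  with C show ?thesis by (auto simp: Chains_def)
qed

text \<open>In height two every strict relation is a cover, so a colour-respecting embedding of the
  Hasse diagram into the containment graph of two levels is already a rank-preserving copy. The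
  bound for tree-free bipartite graphs therefore applies.\<close>

lemma level_pairs_le_if_no_copy:
  fixes T :: "'a set" and F :: "nat set set"
  assumes T: "tree_poset T r" "poset_height T r = 2" and F: "finite F"
    and free: "\<not> (\<exists>\<G>. \<G> \<subseteq> F \<and> rank_preserving_copy T r \<G>)" and ij: "i < j"
  shows "card {(A, B) \<in> F \<times> F. card A = i \<and> card B = j \<and> A \<subset> B} \<le>
    2 * card T * (card {A \<in> F. card A = i} + card {A \<in> F. card A = j})"
proof -
  have finT: "finite T" and po: "partial_order_on T r" and tree: "graph_tree T (hasse_diagram T r)"
    using T by (auto simp: tree_poset_def)
  note no3 = height_two_no_chain_three[OF finT po T(2)]
  have cov: "covered_by T r x y" if "(x, y) \<in> r" "x \<noteq> y" "x \<in> T" "y \<in> T" for x y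
    using that no3 by (auto simp: covered_by_def)
  \<comment> \<open>\<open>c\<close> marks the upper elements of \<open>T\<close> and
    \<open>d\<close> the upper level; matching them ensures that the tree is not embedded upside
    down.\<close>
  define c where "c x \<longleftrightarrow> (\<exists>w. covered_by T r w x)" for x
  have c: "\<not> c x" "c y" if "covered_by T r x y" for x y
    using that no3 unfolding c_def covered_by_def by blast+
  define V where "V = {A \<in> F. card A = i} \<union> {A \<in> F. card A = j}"
  define H where "H = {(A, B) \<in> F \<times> F. card A = i \<and> card B = j \<and> A \<subset> B}"
  define d where "d A \<longleftrightarrow> card A = j" for A :: "nat set"
  have "card (H \<inter> V \<times> V) \<le> 2 * card T * card V"
  proof (rule bipartite_edges_le_if_tree_free[OF tree finT, where c = c and d = d])
    show "hasse_diagram T r \<subseteq> T \<times> T" by (auto simp: hasse_diagram_def covered_by_def)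
    show "sym (hasse_diagram T r)" by (auto simp: hasse_diagram_def sym_def)
    show "c x \<noteq> c y" if "(x, y) \<in> hasse_diagram T r" for x y
      using that c by (auto simp: hasse_diagram_def)
    show "d A \<noteq> d B" if "(A, B) \<in> H" for A B using that ij by (auto simp: H_def d_def)
    show "finite V" using F by (auto simp: V_def)
    show "\<not> (\<exists>f. inj_on f T \<and> f ` T \<subseteq> V \<and> (\<forall>x\<in>T. d (f x) = c x) \<and>
             (\<forall>x y. (x, y) \<in> hasse_diagram T r \<longrightarrow> (f x, f y) \<in> H \<union> H\<inverse>))"
    proof
      assume "\<exists>f. inj_on f T \<and> f ` T \<subseteq> V \<and> (\<forall>x\<in>T. d (f x) = c x) \<and>
             (\<forall>x y. (x, y) \<in> hasse_diagram T r \<longrightarrow> (f x, f y) \<in> H \<union> H\<inverse>)"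
      then obtain f where f: "inj_on f T" "f ` T \<subseteq> V" "\<And>x. x \<in> T \<Longrightarrow> d (f x) = c x"
        "\<And>x y. (x, y) \<in> hasse_diagram T r \<Longrightarrow> (f x, f y) \<in> H \<union> H\<inverse>" by blast
      let ?\<rho> = "\<lambda>x. if c x then 1 else 0 :: int"
      have "rank_function T r ?\<rho>" using c by (simp add: rank_function_def)
      moreover have "rank_preserving_copy_wrt T r ?\<rho> (f ` T)"
        unfolding rank_preserving_copy_wrt_def
      proof (intro exI[of _ f] conjI ballI impI)
        show "bij_betw f T (f ` T)" using f(1) by (simp add: bij_betw_def)
        show "f x \<subseteq> f y" if xy: "x \<in> T" "y \<in> T" "(x, y) \<in> r" for x y
        proof (cases "x = y")
          case False
          then have cxy: "covered_by T r x y" using cov xy by blast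
          then have "(f x, f y) \<in> H \<union> H\<inverse>" by (intro f(4)) (simp add: hasse_diagram_def)
          moreover have "d (f y)" using f(3) xy c(2)[OF cxy] by simp
          ultimately show ?thesis using ij by (auto simp: H_def d_def)
        qed simp
        show "card (f x) = card (f y)" if xy: "x \<in> T" "y \<in> T" "?\<rho> x = ?\<rho> y" for x y
        proof -
          have "d (f x) = d (f y)" using f(3) xy by (auto split: if_splits)
          moreover have "f x \<in> V" "f y \<in> V" using f(2) xy by auto
          ultimately show ?thesis by (auto simp: V_def d_def)
        qed
      qed
      ultimately have "rank_preserving_copy T r (f ` T)"
        unfolding rank_preserving_copy_def by blast
      moreover have "f ` T \<subseteq> F" using f(2) by (auto simp: V_def)
      ultimately show False using free by blast
    qed
  qed
  moreover have "H \<inter> V \<times> V = H" by (auto simp: H_def V_def)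
  moreover have "card V \<le> card {A \<in> F. card A = i} + card {A \<in> F. card A = j}"
    unfolding V_def by (rule card_Un_le)
  ultimately show ?thesis
    unfolding H_def by (metis (no_types, lifting) mult_le_mono2 order_trans)
qed

section \<open>Lower and upper bounds for \<open>La_rp\<close>\<close>

lemma finite_La_rp_set:
  "finite {card \<F> | \<F>. \<F> \<subseteq> Pow {1..n} \<and> \<not> (\<exists>\<G>. \<G> \<subseteq> \<F> \<and> rank_preserving_copy P r \<G>)}"
  by (rule finite_subset[of _ "card ` Pow (Pow {1..n})"]) auto

text \<open>A copy would contain two distinct nested sets, which cannot have equal size.\<close>

lemma La_rp_ge_middle_layer:
  assumes T: "tree_poset T r" "poset_height T r = 2"
  shows "n choose (n div 2) \<le> La_rp n T r"
proof -
  let ?F = "{A. A \<subseteq> {1..n} \<and> card A = n div 2}"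
  have "\<not> rank_preserving_copy T r \<G>" if "\<G> \<subseteq> ?F" for \<G>
  proof
    assume "rank_preserving_copy T r \<G>"
    then obtain f where f: "bij_betw f T \<G>" "\<And>x y. x \<in> T \<Longrightarrow> y \<in> T \<Longrightarrow> (x, y) \<in> r \<Longrightarrow> f x \<subseteq> f y"
      unfolding rank_preserving_copy_def rank_preserving_copy_wrt_def by blast
    obtain x y where xy: "x \<in> T" "y \<in> T" "(x, y) \<in> r" "x \<noteq> y"
      using height_two_ex_strict_pair T by (metis tree_poset_def)
    have "f x \<in> ?F" "f y \<in> ?F" using f(1) xy that by (auto simp: bij_betw_def)
    then have "finite (f y)" "card (f x) = card (f y)" by (auto intro: finite_subset)
    then have "f x = f y" using f(2)[OF xy(1-3)] by (simp add: card_subset_eq)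
    with f(1) xy show False by (auto simp: bij_betw_def inj_on_def)
  qed
  then have "card ?F \<le> La_rp n T r"
    unfolding La_rp_def by (intro Max_ge finite_La_rp_set) blast
  then show ?thesis by (simp add: n_subsets)
qed

text \<open>The central levels are handled by \<open>card_sparse_family_le\<close> with
  \<open>K = 2 * card T\<close> and \<open>a = n div 4\<close>, so \<open>n\<close> is the condition
  \<open>16 * K \<le> a\<close>. The last error term pays for the extreme levels.\<close>

lemma La_rp_le:
  fixes T :: "'a set"
  assumes T: "tree_poset T r" "poset_height T r = 2" and n: "32 * card T \<le> n div 4"
  shows "real (La_rp n T r) \<le>
    (1 + 32 * card T / real (n div 4) + (real n + 1) / 2 ^ (n div 12)) * (n choose (n div 2))"
proof -
  let ?S = "{card \<F> | \<F>. \<F> \<subseteq> Pow {1..n} \<and> \<not> (\<exists>\<G>. \<G> \<subseteq> \<F> \<and> rank_preserving_copy T r \<G>)}"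
  let ?M = "n choose (n div 2)"
  have "T \<noteq> {}" "finite T" using T by (auto simp: tree_poset_def graph_tree_def graph_connected_def)
  then have a: "0 < n div 4" using n card_gt_0_iff[of T] by linarith
  have "\<not> rank_preserving_copy T r {}"
    using \<open>T \<noteq> {}\<close> by (auto simp: rank_preserving_copy_def rank_preserving_copy_wrt_def bij_betw_def)
  \<comment> \<open>The empty family witnesses that the maximum ranges over a nonempty set and is
    attained.\<close>
  then have "card {} \<in> ?S" by (intro CollectI exI[of _ "{}"]) auto
  then have "La_rp n T r \<in> ?S"
    unfolding La_rp_def by (intro Max_in finite_La_rp_set) blast
  then obtain F where F: "F \<subseteq> Pow {1..n}" "\<not> (\<exists>\<G>. \<G> \<subseteq> F \<and> rank_preserving_copy T r \<G>)"
    "La_rp n T r = card F" by blast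
  let ?P = "\<lambda>A. n div 4 \<le> card A \<and> card A \<le> n - n div 4"
  let ?F = "{A \<in> F. ?P A}" and ?D = "{A \<in> Pow {1..n}. \<not> ?P A}"
  have finF: "finite F" using F finite_subset by blast
  have "card F \<le> card (?F \<union> ?D)" using F finF by (intro card_mono) auto
  also have "\<dots> \<le> card ?F + card ?D" by (rule card_Un_le)
  finally have "real (card F) \<le> real (card ?F) + real (card ?D)" by linarith
  also have "real (card ?F) \<le> (1 + 16 * real (2 * card T) / real (n div 4)) * ?M"
  proof (rule card_sparse_family_le)
    fix i j :: nat assume ij: "i < j"
    have "\<not> (\<exists>\<G>. \<G> \<subseteq> ?F \<and> rank_preserving_copy T r \<G>)" using F(2) by blast
    from level_pairs_le_if_no_copy[OF T _ this ij] finF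
    have "card {(A, B) \<in> ?F \<times> ?F. card A = i \<and> card B = j \<and> A \<subset> B} \<le>
      2 * card T * (card {A \<in> ?F. card A = i} + card {A \<in> ?F. card A = j})" by simp
    then show "real (card {(A, B) \<in> ?F \<times> ?F. card A = i \<and> card B = j \<and> A \<subset> B}) \<le>
      real (2 * card T) * (card {A \<in> ?F. card A = i} + card {A \<in> ?F. card A = j})"
      by (simp only: of_nat_add[symmetric] of_nat_mult[symmetric] of_nat_le_iff)
  qed (use F n a in auto)
  also have "real (card ?D) \<le> (real n + 1) / 2 ^ (n div 12) * ?M" by (rule card_extreme_sets_le)
  finally show ?thesis unfolding F(3) by (simp add: algebra_simps)
qed

theorem theorem1p2:
  fixes T :: "'a set" and r :: "'a rel"
  assumes "tree_poset T r"
    and "poset_height T r = 2"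
  shows "\<exists>C::real. \<forall>\<^sub>F n in sequentially.
    \<bar>real (La_rp n T r) / real (n choose (n div 2)) - 1\<bar> \<le> C * sqrt (ln (real n) / real n)"
proof (intro exI)
  let ?k = "real (card T)"
  \<comment> \<open>Both error terms, of order \<open>1 / n\<close> and exponentially small, are
    absorbed by the square root. The exponent \<open>n / 12 - 1\<close> is a smooth lower bound for
    \<open>n div 12\<close>.\<close>
  have ev1: "\<forall>\<^sub>F n in sequentially. 1 / real n \<le> sqrt (ln (real n) / real n)"
    by real_asymp
  have ev2: "\<forall>\<^sub>F n in sequentially.
      (real n + 1) / 2 powr (real n / 12 - 1) \<le> sqrt (ln (real n) / real n)"
    by real_asymp
  show "\<forall>\<^sub>F n in sequentially. \<bar>real (La_rp n T r) / real (n choose (n div 2)) - 1\<bar> \<le>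
      (256 * ?k + 1) * sqrt (ln (real n) / real n)"
    using ev1 ev2 eventually_ge_at_top[of "128 * card T + 8"]
  proof eventually_elim
    case (elim n)
    let ?M = "n choose (n div 2)" and ?s = "sqrt (ln (real n) / real n)"
    have M: "0 < real ?M" by (simp add: zero_less_binomial_iff)
    have "32 * card T \<le> n div 4" using elim(3) by linarith
    from La_rp_le[OF assms this]
    have "real (La_rp n T r) / ?M - 1 \<le> 32 * ?k / real (n div 4) + (real n + 1) / 2 ^ (n div 12)"
      using M by (simp add: field_simps)
    \<comment> \<open>From \<open>n \<ge> 8\<close> on, \<open>n div 4\<close> is at least
      \<open>n / 8\<close>; hence the constant 256.\<close>
    also have "32 * ?k / real (n div 4) \<le> 32 * ?k / (real n / 8)"
      using elim(3) by (intro divide_left_mono mult_pos_pos) linarith+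
    also have "\<dots> = 256 * ?k * (1 / n)" by simp
    also have "\<dots> \<le> 256 * ?k * ?s" using elim(1) by (intro mult_left_mono) auto
    also have "(real n + 1) / 2 ^ (n div 12) \<le> (real n + 1) / 2 powr (real n / 12 - 1)"
    proof (rule divide_left_mono)
      have "2 powr (real n / 12 - 1) \<le> 2 powr real (n div 12)"
        by (intro powr_mono) linarith+
      then show "2 powr (real n / 12 - 1) \<le> (2::real) ^ (n div 12)" by (simp add: powr_realpow)
    qed auto
    also have "\<dots> \<le> ?s" by (rule elim(2))
    finally have "real (La_rp n T r) / ?M - 1 \<le> (256 * ?k + 1) * ?s" by (simp add: algebra_simps)
    moreover have "0 \<le> real (La_rp n T r) / ?M - 1"
      using La_rp_ge_middle_layer[OF assms, of n] M by (simp add: field_simps)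
    ultimately show ?case by linarith
  qed
qed

end
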